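(* Let $T>0$, let $\mathcal{L}=\{1,\dots,d\}$, let $x^1,\dots,x^d:[0,T]\to\mathbb{R}$ be smooth functions, and let $X:\mathcal{A}\mathcal{T}_{\mathcal{L}}\to\mathcal{C}_2^+$ be the algebra homomorphism given by the tree-indexed iterated integrals of $x=(x^a)_{a\in\mathcal{L}}$ (defined in the context). Then for every $\sigma\in\mathcal{A}\mathcal{T}_{\mathcal{L}}$ $$\delta X^{\sigma}=X^{\Delta'(\sigma)},$$ where $\Delta'$ is the reduced coproduct $\Delta'(\sigma)=\Delta(\sigma)-1\otimes\sigma-\sigma\otimes 1$.
   Context: Trees. An $\mathcal{L}$-labeled rooted tree is a finite rooted tree (the order of branches at a vertex is irrelevant) each of whose vertices carries a label in $\mathcal{L}$; $\mathcal{T}_{\mathcal{L}}$ is the set of these trees. $\bullet_a$ is the one-vertex tree with label $a$, and $[\tau_1\cdots\tau_k]_a$ is the tree obtained by attaching the roots of $\tau_1,\dots,\tau_k$ to a new root with label $a$. $\mathcal{A}\mathcal{T}_{\mathcal{L}}$ is the unital commutative polynomial algebra over $\mathbb{R}$ generated by $\mathcal{T}_{\mathcal{L}}$; its monomials $\tau_1\cdots\tau_n$ are called forests (including the empty forest $1$). $B_+^a$ is the linear map on $\mathcal{A}\mathcal{T}_{\mathcal{L}}$ with $B_+^a(1)=\bullet_a$, $B_+^a(\tau_1\cdots\tau_n)=[\tau_1\cdots\tau_n]_a$. The coproduct $\Delta:\mathcal{A}\mathcal{T}_{\mathcal{L}}\to\mathcal{A}\mathcal{T}_{\mathcal{L}}\otimes\mathcal{A}\mathcal{T}_{\mathcal{L}}$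 is the unital algebra homomorphism determined recursively on trees by $\Delta(B_+^a(\sigma))=1\otimes B_+^a(\sigma)+(B_+^a\otimes\mathrm{id})\Delta(\sigma)$ for every forest $\sigma$ and $a\in\mathcal{L}$. Increments. $\mathcal{C}_2$ is the set of functions $g:[0,T]^2\to\mathbb{R}$, $(t,s)\mapsto g_{ts}$, with $g_{tt}=0$; $\mathcal{C}_2^+=\mathcal{C}_2\oplus\mathbb{R}e$ with $e_{ts}=1$ for all $t,s$. For $h\in\mathcal{C}_2^+$, $(\delta h)_{tus}=h_{ts}-h_{tu}-h_{us}$. For $g,h\in\mathcal{C}_2^+$ the exterior product is $(gh)_{tus}=g_{tu}h_{us}$ and the inner product is $(g\circ h)_{ts}=g_{ts}h_{ts}$. Iterated integrals. $X^{\bullet_a}_{ts}=\int_s^t dx^a_u$, $X^{[\tau^1\cdots\tau^k]_a}_{ts}=\int_s^t\prod_{i=1}^kX^{\tau^i}_{us}\,dx^a_u$; $X$ is extended to $\mathcal{A}\mathcal{T}_{\mathcal{L}}$ linearly, with $X^1=e$ and $X^{\tau_1\cdots\tau_n}_{ts}=X^{\tau_1}_{ts}\cdots X^{\tau_n}_{ts}$. On $\mathcal{A}\mathcal{T}_{\mathcal{L}}\otimes\mathcal{A}\mathcal{T}_{\mathcal{L}}$, $X$ is defined by linearity and $X^{\sigma\otimes\rho}=X^{\sigma}X^{\rho}$ (exterior product), i.e. $X^{\sigma\otimes\rho}_{tus}=X^\sigma_{tu}X^\rho_{us}$. *)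

theory Defs
  imports "HOL-Analysis.Analysis" "HOL-Library.Multiset"
    "HOL-Library.Poly_Mapping" "HOL-Library.Product_Plus"
begin

section \<open>Labelled rooted trees and the algebra of forests\<close>

text \<open>
  Branches form a multiset, so their order is irrelevant. A forest is a multiset of trees,
  i.e. a monomial of the free commutative monoid on the trees, written additively:
  the empty forest is \<open>{#}\<close> and the product of two forests is their multiset sum.
\<close>

datatype (labels: 'l) ltree = Node 'l "'l ltree multiset"

type_synonym 'l forest = "'l ltree multiset"

text \<open>
  The polynomial algebra generated by the trees is the monoid algebra of the forests:
  finitely supported real functions on forests, with convolution as product.
  A forest \<open>F\<close> sits in it as \<open>single F 1\<close>, and the unit is \<open>single {#} 1\<close>.
  The tensor square of a monoid algebra is the monoid algebra of the product monoid, with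
  \<open>single (F, G) 1\<close> standing for the elementary tensor of \<open>F\<close> and \<open>G\<close>.
\<close>

type_synonym 'l forest_alg = "'l forest \<Rightarrow>\<^sub>0 real"
type_synonym 'l forest_alg2 = "('l forest \<times> 'l forest) \<Rightarrow>\<^sub>0 real"

definition trees_over :: "'l set \<Rightarrow> 'l ltree set" where
  "trees_over L = {\<tau>. labels \<tau> \<subseteq> L}"

definition forest_algebra :: "'l set \<Rightarrow> 'l forest_alg set" where
  "forest_algebra L = {\<sigma>. \<forall>F \<in> Poly_Mapping.keys \<sigma>. set_mset F \<subseteq> trees_over L}"

definition lin_ext :: "('a \<Rightarrow> 'b \<Rightarrow>\<^sub>0 real) \<Rightarrow> ('a \<Rightarrow>\<^sub>0 real) \<Rightarrow> ('b \<Rightarrow>\<^sub>0 real)" where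
  "lin_ext f p =
     (\<Sum>k \<in> Poly_Mapping.keys p. Poly_Mapping.map ((*) (Poly_Mapping.lookup p k)) (f k))"

definition tensor :: "'l forest_alg \<Rightarrow> 'l forest_alg \<Rightarrow> 'l forest_alg2" (infixr \<open>\<otimes>\<^sub>A\<close> 72) where
  "\<sigma> \<otimes>\<^sub>A \<rho> = (\<Sum>F \<in> Poly_Mapping.keys \<sigma>. \<Sum>G \<in> Poly_Mapping.keys \<rho>.
      Poly_Mapping.single (F, G) (Poly_Mapping.lookup \<sigma> F * Poly_Mapping.lookup \<rho> G))"

definition tensor_map ::
  "('l forest_alg \<Rightarrow> 'l forest_alg) \<Rightarrow> ('l forest_alg \<Rightarrow> 'l forest_alg) \<Rightarrow> 'l forest_alg2 \<Rightarrow> 'l forest_alg2"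
where
  "tensor_map f g =
     lin_ext (\<lambda>(F, G). f (Poly_Mapping.single F 1) \<otimes>\<^sub>A g (Poly_Mapping.single G 1))"

definition Bplus :: "'l \<Rightarrow> 'l forest_alg \<Rightarrow> 'l forest_alg" where
  "Bplus a = lin_ext (\<lambda>F. Poly_Mapping.single {#Node a F#} 1)"


section \<open>The coproduct\<close>

primrec tree_coproduct :: "'l ltree \<Rightarrow> 'l forest_alg2" where
  "tree_coproduct (Node a F) =
     1 \<otimes>\<^sub>A Bplus a (Poly_Mapping.single F 1)
     + tensor_map (Bplus a) id (prod_mset (image_mset tree_coproduct F))"

definition coproduct :: "'l forest_alg \<Rightarrow> 'l forest_alg2" where
  "coproduct = lin_ext (\<lambda>F. prod_mset (image_mset tree_coproduct F))"

definition reduced_coproduct :: "'l forest_alg \<Rightarrow> 'l forest_alg2" where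
  "reduced_coproduct \<sigma> = coproduct \<sigma> - 1 \<otimes>\<^sub>A \<sigma> - \<sigma> \<otimes>\<^sub>A 1"


section \<open>Increments\<close>

text \<open>
  Functions on \<open>[0,T]\<^sup>2\<close> and \<open>[0,T]\<^sup>3\<close> are represented by functions on the reals;
  only their values at arguments in \<open>{0..T}\<close> are meaningful. The arguments are written
  in the order of the subscripts, \<open>g t s\<close> for \<open>g\<^bsub>ts\<^esub>\<close> and \<open>h t u s\<close> for \<open>h\<^bsub>tus\<^esub>\<close>.
\<close>

definition incr_delta :: "(real \<Rightarrow> real \<Rightarrow> real) \<Rightarrow> real \<Rightarrow> real \<Rightarrow> real \<Rightarrow> real" where
  "incr_delta h t u s = h t s - h t u - h u s"

definition ext_prod ::
  "(real \<Rightarrow> real \<Rightarrow> real) \<Rightarrow> (real \<Rightarrow> real \<Rightarrow> real) \<Rightarrow> real \<Rightarrow> real \<Rightarrow> real \<Rightarrow> real" where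
  "ext_prod g h t u s = g t u * h u s"


section \<open>Iterated integrals\<close>

text \<open>Infinite differentiability on \<open>[0,T]\<close>, with one-sided derivatives at the endpoints.\<close>

definition smooth_on_interval :: "real \<Rightarrow> (real \<Rightarrow> real) \<Rightarrow> bool" where
  "smooth_on_interval T f \<longleftrightarrow>
     (\<exists>D :: nat \<Rightarrow> real \<Rightarrow> real. (\<forall>u \<in> {0..T}. D 0 u = f u) \<and>
        (\<forall>n. \<forall>u \<in> {0..T}. (D n has_real_derivative D (Suc n) u) (at u within {0..T})))"

text \<open>
  The differential of a smooth path is its derivative times Lebesgue measure. The integral from
  \<open>s\<close> to \<open>t\<close> is oriented (\<open>LBINT\<close> changes sign when the bounds are exchanged),
  so that it makes sense for all \<open>s\<close> and \<open>t\<close> in \<open>[0,T]\<close>, in either order.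
  For \<open>F = {#}\<close> the product is 1, which gives the one-vertex trees.
\<close>

primrec tree_integral ::
  "real \<Rightarrow> ('l \<Rightarrow> real \<Rightarrow> real) \<Rightarrow> 'l ltree \<Rightarrow> real \<Rightarrow> real \<Rightarrow> real" where
  "tree_integral T x (Node a F) = (\<lambda>t s.
     LBINT u=s..t. prod_mset (image_mset (\<lambda>X. X u s) (image_mset (tree_integral T x) F))
       * vector_derivative (x a) (at u within {0..T}))"

definition forest_integral ::
  "real \<Rightarrow> ('l \<Rightarrow> real \<Rightarrow> real) \<Rightarrow> 'l forest \<Rightarrow> real \<Rightarrow> real \<Rightarrow> real" where
  "forest_integral T x F t s = prod_mset (image_mset (\<lambda>\<tau>. tree_integral T x \<tau> t s) F)"

definition iter_integral ::
  "real \<Rightarrow> ('l \<Rightarrow> real \<Rightarrow> real) \<Rightarrow> 'l forest_alg \<Rightarrow> real \<Rightarrow> real \<Rightarrow> real" where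
  "iter_integral T x \<sigma> t s =
     (\<Sum>F \<in> Poly_Mapping.keys \<sigma>. Poly_Mapping.lookup \<sigma> F * forest_integral T x F t s)"

definition iter_integral2 ::
  "real \<Rightarrow> ('l \<Rightarrow> real \<Rightarrow> real) \<Rightarrow> 'l forest_alg2 \<Rightarrow> real \<Rightarrow> real \<Rightarrow> real \<Rightarrow> real" where
  "iter_integral2 T x \<theta> t u s =
     (\<Sum>(F, G) \<in> Poly_Mapping.keys \<theta>. Poly_Mapping.lookup \<theta> (F, G) *
        ext_prod (iter_integral T x (Poly_Mapping.single F 1))
                 (iter_integral T x (Poly_Mapping.single G 1)) t u s)"


section \<open>The defining properties\<close>

text \<open>
  \<open>coproduct\<close> is a unital algebra homomorphism satisfying the usual recursion on trees;
  \<open>iter_integral\<close> is an algebra homomorphism into the increments under the pointwise product,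
  with constant value on the diagonal, and the tensor product goes to the exterior product.
\<close>

lemma poly_mapping_sum_singles:
  "p = (\<Sum>k \<in> Poly_Mapping.keys p. Poly_Mapping.single k (Poly_Mapping.lookup p k))"
  by (rule poly_mapping_eqI)
     (auto simp: lookup_sum lookup_single when_def not_in_keys_iff_lookup_eq_zero)

lemma forest_poly_induct [case_names zero single add]:
  fixes p :: "'a \<Rightarrow>\<^sub>0 real"
  assumes "P 0" and "\<And>k c. P (Poly_Mapping.single k c)" and "\<And>p q. P p \<Longrightarrow> P q \<Longrightarrow> P (p + q)"
  shows "P p"
proof -
  have "P (\<Sum>k \<in> A. Poly_Mapping.single k (Poly_Mapping.lookup p k))" if "finite A" for A
    using that by (induction A) (auto intro: assms)
  from this[OF finite_keys, of p] show ?thesis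
    using poly_mapping_sum_singles[of p] by simp
qed

lemma lookup_map_times:
  "Poly_Mapping.lookup (Poly_Mapping.map ((*) (c::real)) p) k = c * Poly_Mapping.lookup p k"
  by (simp add: map.rep_eq when_def)

lemma lin_ext_single:
  "lin_ext f (Poly_Mapping.single k c) = Poly_Mapping.map ((*) c) (f k)"
  by (rule poly_mapping_eqI) (simp add: lin_ext_def lookup_map_times)

lemma lookup_lin_ext:
  assumes "finite S" and "Poly_Mapping.keys p \<subseteq> S"
  shows "Poly_Mapping.lookup (lin_ext f p) j
    = (\<Sum>k \<in> S. Poly_Mapping.lookup p k * Poly_Mapping.lookup (f k) j)"
proof -
  have "Poly_Mapping.lookup (lin_ext f p) j
    = (\<Sum>k \<in> Poly_Mapping.keys p. Poly_Mapping.lookup p k * Poly_Mapping.lookup (f k) j)"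
    by (simp add: lin_ext_def lookup_sum map.rep_eq when_def) (rule sum.cong; simp)
  also have "\<dots> = (\<Sum>k \<in> S. Poly_Mapping.lookup p k * Poly_Mapping.lookup (f k) j)"
    by (rule sum.mono_neutral_left) (use assms in \<open>auto simp: not_in_keys_iff_lookup_eq_zero\<close>)
  finally show ?thesis .
qed

lemma lin_ext_zero: "lin_ext f 0 = 0"
  by (simp add: lin_ext_def)

lemma lin_ext_add: "lin_ext f (p + q) = lin_ext f p + lin_ext f q"
proof (rule poly_mapping_eqI)
  fix j
  let ?S = "Poly_Mapping.keys p \<union> Poly_Mapping.keys q"
  have "Poly_Mapping.keys (p + q) \<subseteq> ?S" by (rule Poly_Mapping.keys_add)
  then show "Poly_Mapping.lookup (lin_ext f (p + q)) j = Poly_Mapping.lookup (lin_ext f p + lin_ext f q) j"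
    by (simp add: lookup_add lookup_lin_ext[of ?S] algebra_simps sum.distrib)
qed

lemma lin_ext_scale: "lin_ext f (Poly_Mapping.map ((*) c) p) = Poly_Mapping.map ((*) c) (lin_ext f p)"
proof (rule poly_mapping_eqI)
  fix j
  have "Poly_Mapping.keys (Poly_Mapping.map ((*) c) p) \<subseteq> Poly_Mapping.keys p"
    by (auto simp: in_keys_iff lookup_map_times)
  then show "Poly_Mapping.lookup (lin_ext f (Poly_Mapping.map ((*) c) p)) j
      = Poly_Mapping.lookup (Poly_Mapping.map ((*) c) (lin_ext f p)) j"
    by (simp add: lookup_lin_ext[of "Poly_Mapping.keys p"] lookup_map_times sum_distrib_left mult.assoc)
qed

lemma lin_ext_mult:
  fixes f :: "'a::comm_monoid_add \<Rightarrow> 'b::comm_monoid_add \<Rightarrow>\<^sub>0 real"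
  assumes f: "\<And>k l. f (k + l) = f k * f l"
  shows "lin_ext f (p * q) = lin_ext f p * lin_ext f q"
proof (induction p rule: forest_poly_induct)
  case (single k c)
  show ?case
  proof (induction q rule: forest_poly_induct)
    case (single l e)
    have "Poly_Mapping.single 0 (c * e) = Poly_Mapping.single 0 c * Poly_Mapping.single (0::'b) e"
      by (simp add: mult_single)
    then show ?case
      by (simp add: mult_single lin_ext_single f mult_map_scale_conv_mult ac_simps)
  qed (simp_all add: lin_ext_zero lin_ext_add distrib_left)
qed (simp_all add: lin_ext_zero lin_ext_add distrib_right)

lemma Bplus_forest: "Bplus a (Poly_Mapping.single F 1) = Poly_Mapping.single {#Node a F#} 1"
  by (simp add: Bplus_def lin_ext_single)

lemma lookup_tensor:
  "Poly_Mapping.lookup (\<sigma> \<otimes>\<^sub>A \<rho>) (F, G) = Poly_Mapping.lookup \<sigma> F * Poly_Mapping.lookup \<rho> G"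
proof -
  have *: "(\<Sum>k' \<in> Poly_Mapping.keys p. if k' = k then Poly_Mapping.lookup p k' else 0)
      = Poly_Mapping.lookup p k" for p :: "'a forest_alg" and k
    by (auto simp: in_keys_iff)
  have "Poly_Mapping.lookup (\<sigma> \<otimes>\<^sub>A \<rho>) (F, G) =
    (\<Sum>F' \<in> Poly_Mapping.keys \<sigma>. \<Sum>G' \<in> Poly_Mapping.keys \<rho>.
       (if F' = F then Poly_Mapping.lookup \<sigma> F' else 0) * (if G' = G then Poly_Mapping.lookup \<rho> G' else 0))"
    unfolding tensor_def lookup_sum by (intro sum.cong refl) (auto simp: lookup_single when_def)
  then show ?thesis by (simp only: sum_product[symmetric] *)
qed

lemma keys_tensor:
  "Poly_Mapping.keys (\<sigma> \<otimes>\<^sub>A \<rho>) = Poly_Mapping.keys \<sigma> \<times> Poly_Mapping.keys \<rho>"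
  by (auto simp: in_keys_iff lookup_tensor)

lemma coproduct_one: "coproduct 1 = 1"
proof -
  have "coproduct (Poly_Mapping.single {#} 1) = 1"
    unfolding coproduct_def lin_ext_single
    by (rule poly_mapping_eqI) (simp add: map.rep_eq when_def)
  then show ?thesis by simp
qed

lemma coproduct_mult: "coproduct (\<sigma> * \<rho>) = coproduct \<sigma> * coproduct \<rho>"
  unfolding coproduct_def by (rule lin_ext_mult) simp

lemma map_times_one: "Poly_Mapping.map ((*) (1::real)) p = p"
  by (rule poly_mapping_eqI) (simp add: map.rep_eq when_def)

lemma coproduct_Bplus_forest:
  "coproduct (Bplus a (Poly_Mapping.single F 1)) =
     1 \<otimes>\<^sub>A Bplus a (Poly_Mapping.single F 1)
     + tensor_map (Bplus a) id (coproduct (Poly_Mapping.single F 1))"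
  by (simp add: Bplus_forest coproduct_def lin_ext_single map_times_one)

lemma iter_integral_tree:
  "iter_integral T x (Poly_Mapping.single {#Node a F#} 1) t s =
     (LBINT u=s..t. iter_integral T x (Poly_Mapping.single F 1) u s
        * vector_derivative (x a) (at u within {0..T}))"
  by (simp add: iter_integral_def forest_integral_def multiset.map_comp comp_def)

lemma iter_integral_one: "iter_integral T x 1 t s = 1"
  by (simp add: iter_integral_def forest_integral_def flip: single_one)

lemma iter_integral_superset:
  assumes "finite S" and "Poly_Mapping.keys p \<subseteq> S"
  shows "iter_integral T x p t s
    = (\<Sum>k \<in> S. Poly_Mapping.lookup p k * forest_integral T x k t s)"
  unfolding iter_integral_def
  by (rule sum.mono_neutral_left) (use assms in \<open>auto simp: not_in_keys_iff_lookup_eq_zero\<close>)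

lemma iter_integral_add:
  "iter_integral T x (p + q) t s = iter_integral T x p t s + iter_integral T x q t s"
proof -
  let ?S = "Poly_Mapping.keys p \<union> Poly_Mapping.keys q"
  have "Poly_Mapping.keys (p + q) \<subseteq> ?S" by (rule Poly_Mapping.keys_add)
  then show ?thesis
    by (simp add: lookup_add iter_integral_superset[of ?S] algebra_simps sum.distrib)
qed

lemma iter_integral_single:
  "iter_integral T x (Poly_Mapping.single F c) t s = c * forest_integral T x F t s"
  by (simp add: iter_integral_def)

lemma iter_integral_mult:
  "iter_integral T x (p * q) t s = iter_integral T x p t s * iter_integral T x q t s"
proof (induction p rule: forest_poly_induct)
  case (single k c)
  show ?case
  proof (induction q rule: forest_poly_induct)
    case (single l e)
    then show ?case
      by (simp add: mult_single iter_integral_single forest_integral_def)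
  qed (simp_all add: iter_integral_add distrib_left, simp add: iter_integral_def)
qed (simp_all add: iter_integral_add distrib_right, simp add: iter_integral_def)

lemma iter_integral_diagonal: "iter_integral T x \<sigma> t t = Poly_Mapping.lookup \<sigma> {#}"
proof -
  have *: "forest_integral T x F t t = (if F = {#} then 1 else 0)" for F
  proof (cases F)
    case (add \<tau> G)
    then show ?thesis by (cases \<tau>) (simp add: forest_integral_def)
  qed (simp add: forest_integral_def)
  show ?thesis
    by (auto simp: iter_integral_def * if_distrib sum.If_cases in_keys_iff cong: if_cong)
qed

lemma iter_integral2_tensor:
  "iter_integral2 T x (\<sigma> \<otimes>\<^sub>A \<rho>) = ext_prod (iter_integral T x \<sigma>) (iter_integral T x \<rho>)"
  unfolding iter_integral2_def ext_prod_def keys_tensor lookup_tensor iter_integral_single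
    iter_integral_def[of _ _ \<sigma>] iter_integral_def[of _ _ \<rho>] sum_product sum.cartesian_product
  by (intro ext sum.cong) auto

end

theory Submission
  imports Defs
begin

text \<open>
  The terms removed from \<open>\<Delta>\<close> in \<open>\<Delta>'\<close> are those removed by \<open>\<delta>\<close>, so the claim is that the value
  of \<open>X\<close> on \<open>\<Delta>(\<sigma>)\<close> at \<open>(t, u, s)\<close> is \<open>X\<^sup>\<sigma>\<^bsub>ts\<^esub>\<close>. Both sides are linear and multiplicative
  in \<open>\<sigma>\<close>, so it suffices to treat a tree with root label \<open>a\<close> over a forest \<open>\<rho>\<close>, by
  induction. Splitting the outermost integral at \<open>u\<close>, the part from \<open>s\<close> to \<open>u\<close> is the summand
  of \<open>1 \<otimes> B\<^sub>+\<rho>\<close>; in the part from \<open>u\<close> to \<open>t\<close> the integrand \<open>X\<^sup>\<rho>\<^bsub>vs\<^esub>\<close> is expanded at \<open>u\<close>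
  by the induction hypothesis, and integrating the factors \<open>X\<^bsub>vu\<^esub>\<close> against \<open>dx\<^sup>a\<^sub>v\<close> realises \<open>B\<^sub>+ \<otimes> id\<close>.
\<close>

section \<open>Linearity and multiplicativity on the tensor square\<close>

text \<open>Different elements have different key sets; summing over a common finite superset makes
  additivity and scaling facts about ordinary finite sums.\<close>

lemma iter_integral2_superset:
  assumes "finite S" and "Poly_Mapping.keys \<theta> \<subseteq> S"
  shows "iter_integral2 T x \<theta> t u s = (\<Sum>k \<in> S. Poly_Mapping.lookup \<theta> k *
    (forest_integral T x (fst k) t u * forest_integral T x (snd k) u s))"
proof -
  have "iter_integral2 T x \<theta> t u s = (\<Sum>k \<in> Poly_Mapping.keys \<theta>. Poly_Mapping.lookup \<theta> k *
    (forest_integral T x (fst k) t u * forest_integral T x (snd k) u s))"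
    by (auto simp: iter_integral2_def ext_prod_def iter_integral_single intro!: sum.cong)
  also have "\<dots> = (\<Sum>k \<in> S. Poly_Mapping.lookup \<theta> k *
    (forest_integral T x (fst k) t u * forest_integral T x (snd k) u s))"
    by (rule sum.mono_neutral_left) (use assms in \<open>auto simp: not_in_keys_iff_lookup_eq_zero\<close>)
  finally show ?thesis .
qed

lemma iter_integral2_zero [simp]: "iter_integral2 T x 0 t u s = 0"
  by (simp add: iter_integral2_def)

lemma iter_integral2_single:
  "iter_integral2 T x (Poly_Mapping.single (F, G) c) t u s =
    c * (forest_integral T x F t u * forest_integral T x G u s)"
  by (subst iter_integral2_superset[of "{(F, G)}"]) auto

lemma iter_integral2_add:
  "iter_integral2 T x (p + q) t u s = iter_integral2 T x p t u s + iter_integral2 T x q t u s"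
proof -
  let ?S = "Poly_Mapping.keys p \<union> Poly_Mapping.keys q"
  have "Poly_Mapping.keys (p + q) \<subseteq> ?S" by (rule Poly_Mapping.keys_add)
  then show ?thesis
    by (simp add: lookup_add iter_integral2_superset[of ?S] algebra_simps sum.distrib)
qed

lemma iter_integral2_diff:
  "iter_integral2 T x (p - q) t u s = iter_integral2 T x p t u s - iter_integral2 T x q t u s"
  using iter_integral2_add[of T x "p - q" q t u s] by simp

lemma iter_integral2_scale:
  "iter_integral2 T x (Poly_Mapping.map ((*) c) p) t u s = c * iter_integral2 T x p t u s"
proof -
  have "Poly_Mapping.keys (Poly_Mapping.map ((*) c) p) \<subseteq> Poly_Mapping.keys p"
    by (auto simp: in_keys_iff lookup_map_times)
  then show ?thesis
    by (simp add: iter_integral2_superset[of "Poly_Mapping.keys p"] lookup_map_times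
        sum_distrib_left mult.assoc)
qed

lemma iter_integral2_sum:
  "iter_integral2 T x (\<Sum>k \<in> A. f k) t u s = (\<Sum>k \<in> A. iter_integral2 T x (f k) t u s)"
  by (induction A rule: infinite_finite_induct) (simp_all add: iter_integral2_add)

lemma iter_integral2_lin_ext:
  "iter_integral2 T x (lin_ext f p) t u s =
    (\<Sum>k \<in> Poly_Mapping.keys p. Poly_Mapping.lookup p k * iter_integral2 T x (f k) t u s)"
  by (simp add: lin_ext_def iter_integral2_sum iter_integral2_scale)

lemma iter_integral2_one:
  fixes x :: "'l \<Rightarrow> real \<Rightarrow> real"
  shows "iter_integral2 T x 1 t u s = 1"
proof -
  have "(1 :: 'l forest_alg2) = Poly_Mapping.single ({#}, {#}) 1"
    by (simp flip: single_one add: zero_prod_def)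
  then show ?thesis
    by (metis iter_integral2_single forest_integral_def image_mset_empty prod_mset_empty mult_1)
qed

text \<open>By bilinearity it suffices to multiply two basis pairs. Their product is the multiset
  sum in each factor, which \<open>forest_integral\<close> turns into a product of reals.\<close>

lemma iter_integral2_mult:
  "iter_integral2 T x (p * q) t u s = iter_integral2 T x p t u s * iter_integral2 T x q t u s"
proof (induction p rule: forest_poly_induct)
  case (single k c)
  show ?case
  proof (induction q rule: forest_poly_induct)
    case (single l e)
    then show ?case
      by (cases k; cases l)
        (simp add: mult_single iter_integral2_single forest_integral_def ac_simps)
  qed (simp_all add: iter_integral2_add distrib_left)
qed (simp_all add: iter_integral2_add distrib_right)

lemma iter_integral2_prod_mset:
  "iter_integral2 T x (prod_mset (image_mset f F)) t u s =
    prod_mset (image_mset (\<lambda>\<tau>. iter_integral2 T x (f \<tau>) t u s) F)"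
  by (induction F) (simp_all add: iter_integral2_one iter_integral2_mult)

lemma tensor_map_Bplus_id:
  "tensor_map (Bplus a) id = lin_ext (\<lambda>(F, G). Poly_Mapping.single ({#Node a F#}, G) 1)"
  by (simp add: tensor_map_def Bplus_forest tensor_def)

text \<open>Indexing by the keys of \<theta> rather than of its image allows a term-by-term match
  with an integral of \<open>iter_integral2 T x \<theta>\<close>.\<close>

lemma iter_integral2_tensor_map_Bplus:
  "iter_integral2 T x (tensor_map (Bplus a) id \<theta>) t u s =
    (\<Sum>k \<in> Poly_Mapping.keys \<theta>. Poly_Mapping.lookup \<theta> k *
      (tree_integral T x (Node a (fst k)) t u * forest_integral T x (snd k) u s))"
  unfolding tensor_map_Bplus_id iter_integral2_lin_ext
  by (intro sum.cong)
    (auto simp: iter_integral2_single forest_integral_def simp del: tree_integral.simps)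

section \<open>Labels occurring in the coproduct\<close>

text \<open>Only left factors end up under the outer integral, where continuity is needed; right
  factors are evaluated at the fixed pair \<open>(u, s)\<close> and are constants there.\<close>

definition left_over :: "'l set \<Rightarrow> 'l forest_alg2 \<Rightarrow> bool" where
  "left_over L \<theta> \<longleftrightarrow> (\<forall>k \<in> Poly_Mapping.keys \<theta>. set_mset (fst k) \<subseteq> trees_over L)"

lemma left_over_add: "left_over L p \<Longrightarrow> left_over L q \<Longrightarrow> left_over L (p + q)"
  using Poly_Mapping.keys_add[of p q] by (auto simp: left_over_def)

lemma left_over_one: "left_over L 1"
  by (auto simp: left_over_def zero_prod_def simp flip: single_one)

lemma left_over_mult: "left_over L p \<Longrightarrow> left_over L q \<Longrightarrow> left_over L (p * q)"
  using keys_mult[of p q] unfolding left_over_def by fastforce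

lemma left_over_prod_mset:
  "(\<And>\<tau>. \<tau> \<in># F \<Longrightarrow> left_over L (f \<tau>)) \<Longrightarrow> left_over L (prod_mset (image_mset f F))"
  by (induction F) (simp_all add: left_over_one left_over_mult)

lemma left_over_one_tensor: "left_over L (1 \<otimes>\<^sub>A \<sigma>)"
  by (auto simp: left_over_def keys_tensor simp flip: single_one)

lemma left_over_tensor_map_Bplus:
  assumes "a \<in> L" and "left_over L \<theta>"
  shows "left_over L (tensor_map (Bplus a) id \<theta>)"
proof -
  have *: "Poly_Mapping.lookup (tensor_map (Bplus a) id \<theta>) j =
    (\<Sum>k \<in> Poly_Mapping.keys \<theta>. Poly_Mapping.lookup \<theta> k *
      Poly_Mapping.lookup (Poly_Mapping.single ({#Node a (fst k)#}, snd k) 1) j)" for j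
    unfolding tensor_map_Bplus_id
    by (subst lookup_lin_ext[OF finite_keys order_refl]) (simp add: case_prod_beta)
  show ?thesis
    unfolding left_over_def
  proof
    fix j assume "j \<in> Poly_Mapping.keys (tensor_map (Bplus a) id \<theta>)"
    \<comment> \<open>A nonzero coefficient at \<open>j\<close> forces a nonzero summand, whose
      index \<open>k\<close> is a preimage of \<open>j\<close>.\<close>
    then obtain k where k: "k \<in> Poly_Mapping.keys \<theta>" "j = ({#Node a (fst k)#}, snd k)"
      unfolding in_keys_iff *
      by (auto elim!: sum.not_neutral_contains_not_neutral simp: lookup_single when_def split: if_splits)
    then show "set_mset (fst j) \<subseteq> trees_over L"
      using assms by (force simp: left_over_def trees_over_def)
  qed
qed

lemma Node_in_trees_over:
  "Node a F \<in> trees_over L \<longleftrightarrow> a \<in> L \<and> set_mset F \<subseteq> trees_over L"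
  by (auto simp: trees_over_def)

lemma left_over_tree_coproduct: "\<tau> \<in> trees_over L \<Longrightarrow> left_over L (tree_coproduct \<tau>)"
proof (induction \<tau>)
  case (Node a F)
  then show ?case
    by (auto simp: Node_in_trees_over intro!: left_over_add left_over_one_tensor
        left_over_tensor_map_Bplus left_over_prod_mset)
qed

section \<open>Continuity of the iterated integrals\<close>

text \<open>Primitives taken from 0 absorb the orientation: no later argument distinguishes the
  order of the bounds, and splitting an integral becomes cancellation.\<close>

lemma interval_integral_eq_primitive_diff:
  fixes f :: "real \<Rightarrow> real"
  assumes f: "continuous_on {0..T} f" and "s \<in> {0..T}" "t \<in> {0..T}"
  shows "(LBINT v=s..t. f v) = integral {0..t} f - integral {0..s} f"
proof -
  have from_0: "(LBINT v=0..y. f v) = integral {0..y} f" if "y \<in> {0..T}" for y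
  proof -
    have "continuous_on {0..y} f" using f that by (auto intro: continuous_on_subset)
    then show ?thesis
      using interval_integral_eq_integral[of 0 y f] that
      by (simp add: borel_integrable_atLeastAtMost' zero_ereal_def)
  qed
  \<comment> \<open>The splitting rule asks for integrability over the hull of the three end points
    0, \<open>s\<close> and \<open>t\<close>.\<close>
  have "continuous_on {0..max s t} f"
    using assms by (intro continuous_on_subset[OF f]) auto
  then have "interval_lebesgue_integrable lborel 0 (max s t) f"
    using interval_integrable_continuous_on[of 0 "max s t" f] assms
    by (simp add: zero_ereal_def le_max_iff_disj)
  moreover have "min 0 (min (ereal s) (ereal t)) = 0" "max 0 (max (ereal s) (ereal t)) = ereal (max s t)"
    using assms by (auto simp: min_def max_def)
  ultimately have "(LBINT v=0..s. f v) + (LBINT v=s..t. f v) = (LBINT v=0..t. f v)"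
    by (intro interval_integral_sum) simp
  then show ?thesis using from_0 assms by simp
qed

text \<open>On a nondegenerate interval the derivative within it is unique, hence equal to
  \<open>D 1\<close>, which is continuous because it is itself differentiable.\<close>

lemma smooth_on_interval_continuous_vector_derivative:
  assumes "T > 0" and "smooth_on_interval T f"
  shows "continuous_on {0..T} (\<lambda>u. vector_derivative f (at u within {0..T}))"
proof -
  obtain D where D0: "\<And>u. u \<in> {0..T} \<Longrightarrow> D 0 u = f u"
    and D: "\<And>n u. u \<in> {0..T} \<Longrightarrow> (D n has_real_derivative D (Suc n) u) (at u within {0..T})"
    using assms(2) unfolding smooth_on_interval_def by blast
  have "vector_derivative f (at u within {0..T}) = D 1 u" if u: "u \<in> {0..T}" for u
  proof (rule vector_derivative_within_closed_interval)
    have "(f has_real_derivative D 1 u) (at u within {0..T})"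
      using D[OF u, of 0] u D0
      by (auto intro: has_field_derivative_transform_within[OF _ zero_less_one])
    then show "(f has_vector_derivative D 1 u) (at u within {0..T})"
      by (simp add: has_real_derivative_iff_has_vector_derivative)
  qed (use assms u in auto)
  moreover have "continuous_on {0..T} (D 1)"
    by (rule DERIV_continuous_on) (rule D)
  ultimately show ?thesis by (metis (no_types, lifting) continuous_on_cong)
qed

context
  fixes T :: real and L :: "'l set" and x :: "'l \<Rightarrow> real \<Rightarrow> real"
  assumes T: "T > 0" and smooth: "\<And>a. a \<in> L \<Longrightarrow> smooth_on_interval T (x a)"
begin

lemma tree_integral_Node:
  "tree_integral T x (Node a F) t s =
    (LBINT v=s..t. forest_integral T x F v s * vector_derivative (x a) (at v within {0..T}))"
  by (simp add: forest_integral_def multiset.map_comp comp_def)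

lemma continuous_on_forest_integral:
  assumes "\<And>\<tau>. \<tau> \<in># F \<Longrightarrow> continuous_on A (\<lambda>v. tree_integral T x \<tau> v s)"
  shows "continuous_on A (\<lambda>v. forest_integral T x F v s)"
  using assms by (induction F) (auto simp: forest_integral_def intro!: continuous_intros)

text \<open>The base point \<open>s\<close> occurs both as lower bound and inside the integrand.
  With \<open>s\<close> fixed, the integral is a primitive of a continuous function, up to a
  constant.\<close>

lemma continuous_on_tree_integral:
  assumes "\<tau> \<in> trees_over L" and s: "s \<in> {0..T}"
  shows "continuous_on {0..T} (\<lambda>v. tree_integral T x \<tau> v s)"
  using assms(1)
proof (induction \<tau>)
  case (Node a F)
  let ?f = "\<lambda>v. forest_integral T x F v s * vector_derivative (x a) (at v within {0..T})"
  have "continuous_on {0..T} (\<lambda>v. forest_integral T x F v s)"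
    using Node by (intro continuous_on_forest_integral) (auto simp: Node_in_trees_over)
  moreover have "continuous_on {0..T} (\<lambda>v. vector_derivative (x a) (at v within {0..T}))"
    using Node T smooth
    by (auto simp: Node_in_trees_over intro: smooth_on_interval_continuous_vector_derivative)
  ultimately have f: "continuous_on {0..T} ?f" by (rule continuous_on_mult)
  have "continuous_on {0..T} (\<lambda>v. integral {0..v} ?f - integral {0..s} ?f)"
    using f by (intro continuous_on_diff continuous_on_const indefinite_integral_continuous_1 integrable_continuous_real)
  then show ?case
    unfolding tree_integral_Node
    by (rule continuous_on_eq) (rule interval_integral_eq_primitive_diff[OF f s, symmetric])
qed

lemma continuous_on_integrand:
  assumes "set_mset F \<subseteq> trees_over L" and "s \<in> {0..T}" and "a \<in> L"
  shows "continuous_on {0..T}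
    (\<lambda>v. forest_integral T x F v s * vector_derivative (x a) (at v within {0..T}))"
  using assms T smooth
  by (intro continuous_on_mult continuous_on_forest_integral continuous_on_tree_integral
      smooth_on_interval_continuous_vector_derivative) auto

section \<open>The Chen relation\<close>

text \<open>Each right factor depends on \<open>(u, s)\<close> alone and joins the constant
  \<open>?c k\<close>, so it remains to exchange a finite sum with the integral over
  \<open>v\<close>.\<close>

lemma iter_integral2_Bplus_eq_integral:
  assumes \<theta>: "left_over L \<theta>" and a: "a \<in> L" and t: "t \<in> {0..T}" and u: "u \<in> {0..T}"
  shows "iter_integral2 T x (tensor_map (Bplus a) id \<theta>) t u s =
    (LBINT v=u..t. iter_integral2 T x \<theta> v u s * vector_derivative (x a) (at v within {0..T}))"
proof -
  let ?x' = "\<lambda>v. vector_derivative (x a) (at v within {0..T})"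
  let ?g = "\<lambda>k v. forest_integral T x (fst k) v u * ?x' v"
  let ?c = "\<lambda>k. Poly_Mapping.lookup \<theta> k * forest_integral T x (snd k) u s"
  let ?K = "Poly_Mapping.keys \<theta>"
  have g: "continuous_on {0..T} (?g k)" if "k \<in> ?K" for k
    using that \<theta> u a by (intro continuous_on_integrand) (auto simp: left_over_def)
  \<comment> \<open>Needed at \<open>y = t\<close> and \<open>y = u\<close>: linearity is used on
    the primitives, where the order of \<open>u\<close> and \<open>t\<close> is irrelevant.\<close>
  have prim: "integral {0..y} (\<lambda>v. \<Sum>k \<in> ?K. ?c k * ?g k v) = (\<Sum>k \<in> ?K. ?c k * integral {0..y} (?g k))"
    if "y \<in> {0..T}" for y
  proof -
    have "?g k integrable_on {0..y}" if "k \<in> ?K" for k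
      using g[OF that] \<open>y \<in> {0..T}\<close>
      by (intro integrable_continuous_real) (auto intro: continuous_on_subset)
    then show ?thesis
      by (subst integral_sum) (auto intro!: integrable_on_mult_right)
  qed
  have "iter_integral2 T x (tensor_map (Bplus a) id \<theta>) t u s =
      (\<Sum>k \<in> ?K. ?c k * (LBINT v=u..t. ?g k v))"
    unfolding iter_integral2_tensor_map_Bplus tree_integral_Node by (simp add: mult_ac)
  also have "\<dots> = (\<Sum>k \<in> ?K. ?c k * (integral {0..t} (?g k) - integral {0..u} (?g k)))"
    using interval_integral_eq_primitive_diff[OF g u t] by (intro sum.cong) auto
  also have "\<dots> = (LBINT v=u..t. (\<Sum>k \<in> ?K. ?c k * ?g k v))"
    using g by (subst interval_integral_eq_primitive_diff[OF _ u t])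
      (auto simp: prim t u sum_subtractf right_diff_distrib simp del: atLeastAtMost_iff
        intro!: continuous_on_sum continuous_on_mult_left)
  also have "(\<lambda>v. \<Sum>k \<in> ?K. ?c k * ?g k v) = (\<lambda>v. iter_integral2 T x \<theta> v u s * ?x' v)"
    by (simp add: iter_integral2_superset[OF finite_keys order_refl] sum_distrib_left
        sum_distrib_right mult_ac)
  finally show ?thesis .
qed

lemma tree_integral_eq_coproduct:
  assumes "\<tau> \<in> trees_over L" and "t \<in> {0..T}" "u \<in> {0..T}" "s \<in> {0..T}"
  shows "tree_integral T x \<tau> t s = iter_integral2 T x (tree_coproduct \<tau>) t u s"
  using assms
\<comment> \<open>\<open>t\<close> has to vary because the branches are expanded at the intermediate
  times \<open>v\<close>; \<open>u\<close> and \<open>s\<close> stay fixed.\<close>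
proof (induction \<tau> arbitrary: t)
  case (Node a F)
  then have a: "a \<in> L" and F: "set_mset F \<subseteq> trees_over L" by (simp_all add: Node_in_trees_over)
  let ?\<theta> = "prod_mset (image_mset tree_coproduct F)"
  let ?x' = "\<lambda>v. vector_derivative (x a) (at v within {0..T})"
  have IH: "forest_integral T x F v s = iter_integral2 T x ?\<theta> v u s" if "v \<in> {0..T}" for v
    unfolding forest_integral_def iter_integral2_prod_mset
    using Node.IH that F Node.prems by (intro arg_cong[of _ _ prod_mset] image_mset_cong) auto
  have "left_over L ?\<theta>"
    using F by (intro left_over_prod_mset left_over_tree_coproduct) auto
  then have "iter_integral2 T x (tensor_map (Bplus a) id ?\<theta>) t u s =
      (LBINT v=u..t. iter_integral2 T x ?\<theta> v u s * ?x' v)"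
    using a Node.prems by (intro iter_integral2_Bplus_eq_integral)
  \<comment> \<open>Points between \<open>u\<close> and \<open>t\<close>, in either order, lie in
    \<open>{0..T}\<close>, so \<open>IH\<close> applies under the integral.\<close>
  also have "\<dots> = (LBINT v=u..t. forest_integral T x F v s * ?x' v)"
    using Node.prems by (intro interval_integral_cong)
      (auto simp: IH einterval_iff min_def max_def split: if_splits)
  finally have "iter_integral2 T x (tree_coproduct (Node a F)) t u s =
      tree_integral T x (Node a F) u s + (LBINT v=u..t. forest_integral T x F v s * ?x' v)"
    by (simp add: iter_integral2_add iter_integral2_tensor ext_prod_def iter_integral_one
        Bplus_forest iter_integral_single forest_integral_def del: tree_integral.simps)
  \<comment> \<open>Both pieces have the same integrand, with base point \<open>s\<close>, so the
    values of its primitive at \<open>u\<close> cancel.\<close>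
  also have "\<dots> = tree_integral T x (Node a F) t s"
    using Node.prems unfolding tree_integral_Node
    by (simp add: interval_integral_eq_primitive_diff[OF continuous_on_integrand[OF F _ a]])
  finally show ?case by simp
qed

lemma iter_integral_eq_coproduct:
  assumes \<sigma>: "\<sigma> \<in> forest_algebra L" and "t \<in> {0..T}" "u \<in> {0..T}" "s \<in> {0..T}"
  shows "iter_integral T x \<sigma> t s = iter_integral2 T x (coproduct \<sigma>) t u s"
proof -
  have "forest_integral T x F t s =
      iter_integral2 T x (prod_mset (image_mset tree_coproduct F)) t u s"
    if "F \<in> Poly_Mapping.keys \<sigma>" for F
    unfolding forest_integral_def iter_integral2_prod_mset
    using that assms by (intro arg_cong[of _ _ prod_mset] image_mset_cong tree_integral_eq_coproduct)
      (auto simp: forest_algebra_def)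
  then show ?thesis
    by (simp add: coproduct_def iter_integral_def iter_integral2_lin_ext)
qed

end

theorem theorem4p1:
  fixes d :: nat and T :: real and x :: "nat \<Rightarrow> real \<Rightarrow> real" and \<sigma> :: "nat forest_alg"
  assumes "T > 0"
    and "\<And>a. a \<in> {1..d} \<Longrightarrow> smooth_on_interval T (x a)"
    and "\<sigma> \<in> forest_algebra {1..d}"
  shows "\<forall>t \<in> {0..T}. \<forall>u \<in> {0..T}. \<forall>s \<in> {0..T}.
    incr_delta (iter_integral T x \<sigma>) t u s = iter_integral2 T x (reduced_coproduct \<sigma>) t u s"
proof (intro ballI)
  fix t u s assume "t \<in> {0..T}" "u \<in> {0..T}" "s \<in> {0..T}"
  then have "iter_integral T x \<sigma> t s = iter_integral2 T x (coproduct \<sigma>) t u s"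
    using assms by (intro iter_integral_eq_coproduct[where L = "{1..d}"])
  then show "incr_delta (iter_integral T x \<sigma>) t u s = iter_integral2 T x (reduced_coproduct \<sigma>) t u s"
    by (simp add: incr_delta_def reduced_coproduct_def iter_integral2_diff iter_integral2_tensor
        ext_prod_def iter_integral_one)
qed

end
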